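(* Let $G$ be an st-digraph (C-DPP instance). Then: 1. If it is not the case that both $s$ and $t$ have at least one incoming and at least one outgoing arc in $G$, then $\mathrm{tFC}(G)$ is satisfiable. 2. Every minimally unsatisfiable subset $F' \subseteq \mathrm{tFC}(G)$ satisfies $\mathrm{vdeg}_{F'}(x_0) = 4$. 3. $G$ has a special closed walk iff $\mathrm{tFC}(G)$ is unsatisfiable. 4. $G$ has a special cycle iff some minimally unsatisfiable subset of $\mathrm{tFC}(G)$ belongs to Family III. 5. If $G$ does not have a special cycle, then every minimally unsatisfiable subset $F'$ of $\mathrm{tFC}(G)$ has deficiency $\delta(F') \ge 2$.
   Context: Literals are variables and their complements ($\overline{\overline x}=x$); clauses are finite sets of literals without complementary pair; clause-sets are finite sets of clauses. For a clause-set $F$: $\mathrm{ldeg}_F(x)$ is the number of clauses containing literal $x$, $\mathrm{vdeg}_F(v)=\mathrm{ldeg}_F(v)+\mathrm{ldeg}_F(\overline v)$, $n(F)$ the number of variables, $c(F)=|F|$, deficiency $\delta(F)=c(F)-n(F)$, $n_k(F)$ the number of variables $v$ with $\mathrm{vdeg}_F(v)=k$. $F$ is minimally unsatisfiable (MU) if unsatisfiable and every $F\setminus\{C\}$, $C\in F$, is satisfiable; a minimally unsatisfiable subset (MUS) of $F$ is a subset of $F$ that is MU. Family III is the class of MU clause-sets $F$ with all clauses of length $\le 2$ and with $n_3(F)=0$ and $n_4(F)=1$. Fix three distinct variables $s,t,x_0$. An st-digraph is a digraph $G$ (no loops) whose vertices are variables, with $s,t\in V(G)$, $x_0\notin V(G)$,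 and with neither $(s,t)$ nor $(t,s)$ an arc. Define $\tau(s)=x_0$, $\tau(t)=\overline{x_0}$, $\tau(v)=v$ otherwise; for an arc $(a,b)$ let $\tau((a,b))$ be the clause $\{\overline{\tau(a)},\tau(b)\}$; and $\mathrm{tFC}(G)=\{\tau(e): e\in E(G)\}$. $G$ has a special closed walk if there are a directed path $P_1$ from $s$ to $t$ and a directed path $P_2$ from $t$ to $s$; it has a special cycle if such paths exist with $V(P_1)\cap V(P_2)=\{s,t\}$. *)

theory Defs
  imports "Graph_Theory.Pair_Digraph" "Graph_Theory.Vertex_Walk"
begin

datatype 'v literal = Pos 'v | Neg 'v

fun compl_lit :: "'v literal \<Rightarrow> 'v literal" where
  "compl_lit (Pos v) = Neg v"
| "compl_lit (Neg v) = Pos v"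

fun var_lit :: "'v literal \<Rightarrow> 'v" where
  "var_lit (Pos v) = v"
| "var_lit (Neg v) = v"

type_synonym 'v clause = "'v literal set"

definition is_clause :: "'v clause \<Rightarrow> bool" where
  "is_clause C \<longleftrightarrow> finite C \<and> (\<forall>x\<in>C. compl_lit x \<notin> C)"

definition clause_set :: "'v clause set \<Rightarrow> bool" where
  "clause_set F \<longleftrightarrow> finite F \<and> (\<forall>C\<in>F. is_clause C)"

definition vars :: "'v clause set \<Rightarrow> 'v set" where
  "vars F = var_lit ` \<Union>F"

definition ldeg :: "'v clause set \<Rightarrow> 'v literal \<Rightarrow> nat" where
  "ldeg F x = card {C \<in> F. x \<in> C}"

definition vdeg :: "'v clause set \<Rightarrow> 'v \<Rightarrow> nat" where
  "vdeg F v = ldeg F (Pos v) + ldeg F (Neg v)"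

definition num_vars_deg :: "nat \<Rightarrow> 'v clause set \<Rightarrow> nat" where
  "num_vars_deg k F = card {v \<in> vars F. vdeg F v = k}"

definition deficiency :: "'v clause set \<Rightarrow> int" where
  "deficiency F = int (card F) - int (card (vars F))"

fun lit_true :: "('v \<Rightarrow> bool) \<Rightarrow> 'v literal \<Rightarrow> bool" where
  "lit_true \<phi> (Pos v) \<longleftrightarrow> \<phi> v"
| "lit_true \<phi> (Neg v) \<longleftrightarrow> \<not> \<phi> v"

definition satisfiable :: "'v clause set \<Rightarrow> bool" where
  "satisfiable F \<longleftrightarrow> (\<exists>\<phi>. \<forall>C\<in>F. \<exists>x\<in>C. lit_true \<phi> x)"

definition minimally_unsat :: "'v clause set \<Rightarrow> bool" where
  "minimally_unsat F \<longleftrightarrow>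
     clause_set F \<and> \<not> satisfiable F \<and> (\<forall>C\<in>F. satisfiable (F - {C}))"

definition is_MUS :: "'v clause set \<Rightarrow> 'v clause set \<Rightarrow> bool" where
  "is_MUS F' F \<longleftrightarrow> F' \<subseteq> F \<and> minimally_unsat F'"

definition family_III :: "'v clause set \<Rightarrow> bool" where
  "family_III F \<longleftrightarrow>
     minimally_unsat F \<and> (\<forall>C\<in>F. card C \<le> 2) \<and> num_vars_deg 3 F = 0 \<and> num_vars_deg 4 F = 1"


text \<open>Digraphs are finite here, so that the translation below yields a finite set of clauses;
  the vertices are themselves the variables.\<close>

locale st_digraph = pair_digraph G for G :: "'v pair_pre_digraph" +
  fixes s t x0 :: 'v
  assumes distinct_st_x0: "s \<noteq> t" "s \<noteq> x0" "t \<noteq> x0"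
    and s_in_verts: "s \<in> pverts G"
    and t_in_verts: "t \<in> pverts G"
    and x0_notin_verts: "x0 \<notin> pverts G"
    and no_arc_st: "(s, t) \<notin> parcs G"
    and no_arc_ts: "(t, s) \<notin> parcs G"

definition tau :: "'v \<Rightarrow> 'v \<Rightarrow> 'v \<Rightarrow> 'v \<Rightarrow> 'v literal" where
  "tau s t x0 v = (if v = s then Pos x0 else if v = t then Neg x0 else Pos v)"

definition tau_arc :: "'v \<Rightarrow> 'v \<Rightarrow> 'v \<Rightarrow> 'v \<times> 'v \<Rightarrow> 'v clause" where
  "tau_arc s t x0 e = {compl_lit (tau s t x0 (fst e)), tau s t x0 (snd e)}"

definition tFC :: "'v pair_pre_digraph \<Rightarrow> 'v \<Rightarrow> 'v \<Rightarrow> 'v \<Rightarrow> 'v clause set" where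
  "tFC G s t x0 = tau_arc s t x0 ` parcs G"

text \<open>Directed paths do not repeat vertices; they are given by their vertex lists.\<close>

definition dipath :: "'v pair_pre_digraph \<Rightarrow> 'v \<Rightarrow> 'v list \<Rightarrow> 'v \<Rightarrow> bool" where
  "dipath G u p v \<longleftrightarrow> vpath p (with_proj G) \<and> hd p = u \<and> last p = v"

definition special_closed_walk :: "'v pair_pre_digraph \<Rightarrow> 'v \<Rightarrow> 'v \<Rightarrow> bool" where
  "special_closed_walk G s t \<longleftrightarrow> (\<exists>P1 P2. dipath G s P1 t \<and> dipath G t P2 s)"

definition special_cycle :: "'v pair_pre_digraph \<Rightarrow> 'v \<Rightarrow> 'v \<Rightarrow> bool" where
  "special_cycle G s t \<longleftrightarrow>
     (\<exists>P1 P2. dipath G s P1 t \<and> dipath G t P2 s \<and> set P1 \<inter> set P2 = {s, t})"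

lemma (in st_digraph) clause_set_tFC: "clause_set (tFC G s t x0)"
proof -
  have "is_clause (tau_arc s t x0 (a, b))" if ab: "(a, b) \<in> parcs G" for a b
  proof -
    have "a \<noteq> b" "a \<noteq> x0" "b \<noteq> x0"
      using ab no_loops[of "(a, b)"] x0_notin_verts in_arcsD1[OF ab] in_arcsD2[OF ab] by auto
    then show ?thesis
      using ab no_arc_st no_arc_ts distinct_st_x0
      by (auto simp: is_clause_def tau_arc_def tau_def split: if_splits)
  qed
  then show ?thesis
    by (auto simp: clause_set_def tFC_def)
qed

end

theory Submission
  imports Defs
begin

text \<open>An assignment satisfies \<open>tFC(G)\<close> iff its true vertices form a successor-closed set separating
  \<open>s\<close> from \<open>t\<close>, so unsatisfiability means that \<open>s\<close> and \<open>t\<close> reach each other. Therefore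
  the clauses of a minimally unsatisfiable subset are exactly the arcs \<open>E\<close> of two paths, \<open>P\<close> from
  \<open>s\<close> to \<open>t\<close> and \<open>Q\<close> from \<open>t\<close> to \<open>s\<close>. Paths neither re-enter their start nor leave their end, whence
  \<open>x\<^sub>0\<close> has degree 4. If \<open>P\<close> and \<open>Q\<close> are internally disjoint, then every other variable has
  degree 2. Conversely, if \<open>E\<close> is single-valued (all out-degrees are 1), then \<open>P\<close> and \<open>Q\<close> cannot share an
  inner vertex \<open>v\<close>, for their parts after \<open>v\<close> would be comparable although only one of them contains
  \<open>t\<close> and only the other one contains \<open>s\<close>.\<close>

section \<open>Arcs of repetition-free vertex lists\<close>

lemma Domain_vwalk_arcs: "Domain (set (vwalk_arcs p)) = set (butlast p)"
  by (induction p rule: vwalk_arcs.induct) auto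

lemma Range_vwalk_arcs: "Range (set (vwalk_arcs p)) = set (tl p)"
  by (induction p rule: vwalk_arcs.induct) auto

lemma single_valued_vwalk_arcs:
  "distinct p \<Longrightarrow> single_valued (set (vwalk_arcs p))"
proof (induction p rule: vwalk_arcs.induct)
  case (3 x y xs)
  then show ?case
    using arcs_in_vwalk_arcs[of _ "y # xs"] by (fastforce simp: single_valued_def)
qed auto

lemma single_valued_converse_vwalk_arcs:
  assumes "distinct p"
  shows "single_valued ((set (vwalk_arcs p))\<inverse>)"
proof -
  have "(set (vwalk_arcs p))\<inverse> = set (vwalk_arcs (rev p))"
    by (auto simp: set_vwalk_arcs_rev)
  then show ?thesis
    using single_valued_vwalk_arcs[of "rev p"] assms by simp
qed

lemma vwalk_arcs_out: "(v, w) \<in> set (vwalk_arcs p) \<Longrightarrow> v \<in> set (butlast p)"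
  using Domain_vwalk_arcs by fast

lemma vwalk_arcs_in: "(u, v) \<in> set (vwalk_arcs p) \<Longrightarrow> v \<in> set (tl p)"
  using Range_vwalk_arcs by fast

lemma ex1_vwalk_arcs_out:
  assumes "distinct p" "v \<in> set (butlast p)"
  shows "\<exists>!w. (v, w) \<in> set (vwalk_arcs p)"
  using assms(2) single_valued_vwalk_arcs[OF assms(1)]
  unfolding Domain_vwalk_arcs[symmetric] single_valued_def by blast

lemma ex1_vwalk_arcs_in:
  assumes "distinct p" "v \<in> set (tl p)"
  shows "\<exists>!u. (u, v) \<in> set (vwalk_arcs p)"
  using assms(2) single_valued_converse_vwalk_arcs[OF assms(1)]
  unfolding Range_vwalk_arcs[symmetric] single_valued_def by blast

lemma last_notin_butlast: "distinct p \<Longrightarrow> last p \<notin> set (butlast p)"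
  by (induction p) auto

lemma hd_notin_tl: "distinct p \<Longrightarrow> p \<noteq> [] \<Longrightarrow> hd p \<notin> set (tl p)"
  by (cases p) auto

lemma set_butlast_last: "p \<noteq> [] \<Longrightarrow> set p = insert (last p) (set (butlast p))"
  by (induction p) auto

lemma set_hd_tl: "p \<noteq> [] \<Longrightarrow> set p = insert (hd p) (set (tl p))"
  by (cases p) auto

lemma rtrancl_vwalk_arcs:
  "set (vwalk_arcs p) \<subseteq> E \<Longrightarrow> p \<noteq> [] \<Longrightarrow> (hd p, last p) \<in> E\<^sup>*"
  by (induction p rule: vwalk_arcs.induct) (auto intro: converse_rtrancl_into_rtrancl)

text \<open>Each next vertex is forced, so two walks from \<open>v\<close> agree until the shorter
  one stops: one is a prefix of the other.\<close>

lemma single_valued_walks_comparable: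
  assumes "single_valued E"
    and "set (vwalk_arcs (v # xs)) \<subseteq> E" and "set (vwalk_arcs (v # ys)) \<subseteq> E"
  shows "set (v # xs) \<subseteq> set (v # ys) \<or> set (v # ys) \<subseteq> set (v # xs)"
  using assms(2,3)
proof (induction xs arbitrary: v ys)
  case (Cons x xs)
  show ?case
  proof (cases ys)
    case (Cons y ys')
    moreover have "x = y"
      using Cons.prems Cons assms(1) by (auto simp: single_valued_def)
    ultimately show ?thesis
      using Cons.IH[of x ys'] Cons.prems by auto
  qed auto
qed auto

text \<open>The witness \<open>S\<close> is the part of \<open>p\<close> up to the tail of
  \<open>e\<close>. Along \<open>p\<close> only \<open>e\<close> leaves it. The path
  \<open>q\<close> meets \<open>p\<close> only in its two ends, and it stops at \<open>hd p\<close>,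
  so no arc of \<open>q\<close> starts in \<open>S\<close>.\<close>

lemma separating_set_disjoint_paths:
  assumes "distinct p" "distinct q" "p \<noteq> []" "q \<noteq> []" "set p \<inter> set q = {hd p, last p}"
    and "last q = hd p" and "e \<in> set (vwalk_arcs p)"
  shows "\<exists>S. (set (vwalk_arcs p) \<union> set (vwalk_arcs q) - {e}) `` S \<subseteq> S \<and> hd p \<in> S \<and> last p \<notin> S"
proof -
  obtain xs a b ys where p: "p = xs @ a # b # ys" and e: "e = (a, b)"
    using assms(7)
  proof (induction p arbitrary: thesis rule: vwalk_arcs.induct)
    case (3 x y xs)
    show ?case
    proof (cases "e = (x, y)")
      case True
      then show ?thesis
        using 3(2)[of "[]"] by simp
    next
      case False
      then obtain us a b vs where "y # xs = us @ a # b # vs" "e = (a, b)"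
        using 3 by (metis vwalk_arcs.simps(3) set_ConsD)
      then show ?thesis
        using 3(2)[of "x # us"] by simp
    qed
  qed auto
  have arcs: "set (vwalk_arcs p) = insert (a, b) (set (vwalk_arcs (xs @ [a])) \<union> set (vwalk_arcs (b # ys)))"
    using vwalk_arcs_append[of "xs @ [a]" "b # ys"] p by simp
  define S where "S = set (xs @ [a])"
  have last: "last p \<notin> S"
    using assms(1) unfolding S_def p by auto
  moreover have "hd p \<in> S"
    unfolding S_def p by (cases xs) auto
  moreover have "d \<in> S" if cd: "(c, d) \<in> set (vwalk_arcs p) \<union> set (vwalk_arcs q) - {e}" and "c \<in> S" for c d
  proof (cases "(c, d) \<in> set (vwalk_arcs p)")
    case True
    \<comment> \<open>Distinctness of \<open>p\<close> keeps \<open>c\<close> out of the part behind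
      \<open>e\<close>, so the arc lies before \<open>e\<close> and both its ends are in
      \<open>S\<close>.\<close>
    have "c \<notin> set (b # ys)"
      using \<open>c \<in> S\<close> assms(1) unfolding S_def p by auto
    then have "(c, d) \<in> set (vwalk_arcs (xs @ [a]))"
      using True cd arcs_in_vwalk_arcs[of "(c, d)" "b # ys"] unfolding arcs e by auto
    then show ?thesis
      using arcs_in_vwalk_arcs unfolding S_def by fast
  next
    case False
    then have "c \<in> set (butlast q)"
      using cd Domain_vwalk_arcs[of q] by auto
    then have "c \<in> set p \<inter> set q" "c \<noteq> hd p"
      using \<open>c \<in> S\<close> last_notin_butlast[OF assms(2)] assms(6)
      unfolding S_def p by (auto dest: in_set_butlastD)
    then show ?thesis
      using assms(5) last \<open>c \<in> S\<close> by auto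
  qed
  ultimately show ?thesis
    by blast
qed

section \<open>Degrees and variables of the translated clause-set\<close>

lemma dipath_conv:
  "dipath G u p v \<longleftrightarrow> p \<noteq> [] \<and> set p \<subseteq> pverts G \<and> set (vwalk_arcs p) \<subseteq> parcs G \<and>
     distinct p \<and> hd p = u \<and> last p = v"
  by (auto simp: dipath_def vpath_def vwalk_def)

lemma lit_true_compl_lit: "lit_true \<phi> (compl_lit x) \<longleftrightarrow> \<not> lit_true \<phi> x"
  by (cases x) auto

lemma var_lit_compl_lit: "var_lit (compl_lit x) = var_lit x"
  by (cases x) auto

lemma satisfiable_mono: "satisfiable F \<Longrightarrow> F' \<subseteq> F \<Longrightarrow> satisfiable F'"
  unfolding satisfiable_def by blast

context st_digraph
begin

lemma arc_neq_x0: "(a, b) \<in> parcs G \<Longrightarrow> a \<noteq> x0 \<and> b \<noteq> x0"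
  using in_arcsD1 in_arcsD2 x0_notin_verts by blast

text \<open>Every subset of \<open>tFC G s t x0\<close> is the translation of a set of arcs, so this
  makes the lemmas on st-digraphs available for subsets. The vertices are kept, hence
  \<open>s\<close> and \<open>t\<close> remain among them.\<close>

lemma st_digraph_restrict:
  assumes "E \<subseteq> parcs G"
  shows "st_digraph (G\<lparr>parcs := E\<rparr>) s t x0"
proof unfold_locales
  show "finite (parcs (G\<lparr>parcs := E\<rparr>))"
    using finite_subset[OF assms pair_finite_arcs] by simp
qed (use assms distinct_st_x0 s_in_verts t_in_verts x0_notin_verts no_arc_st no_arc_ts
      pair_finite_verts in_arcsD1 in_arcsD2 no_loops in auto)

lemma dipath_restrict:
  assumes "E \<subseteq> parcs G"
  shows "dipath (G\<lparr>parcs := E\<rparr>) u p v \<Longrightarrow> dipath G u p v"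
  using assms by (auto simp: dipath_conv)

lemma in_degree_eq_1_iff: "in_degree (with_proj G) v = 1 \<longleftrightarrow> (\<exists>!u. (u, v) \<in> parcs G)"
proof -
  have "in_arcs (with_proj G) v = (\<lambda>u. (u, v)) ` {u. (u, v) \<in> parcs G}"
    by auto
  then have "in_degree (with_proj G) v = card {u. (u, v) \<in> parcs G}"
    by (simp add: in_degree_def card_image inj_on_def)
  then show ?thesis
    by (auto simp: card_1_singleton_iff set_eq_iff; metis)
qed

lemma out_degree_eq_1_iff: "out_degree (with_proj G) v = 1 \<longleftrightarrow> (\<exists>!w. (v, w) \<in> parcs G)"
proof -
  have "out_arcs (with_proj G) v = Pair v ` {w. (v, w) \<in> parcs G}"
    by auto
  then have "out_degree (with_proj G) v = card {w. (v, w) \<in> parcs G}"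
    by (simp add: out_degree_def card_image inj_on_def)
  then show ?thesis
    by (auto simp: card_1_singleton_iff set_eq_iff; metis)
qed

text \<open>A clause is an unordered pair, so two arcs could also agree crosswise. That would put
  all four endpoints into \<open>{s, t}\<close>, which is excluded since there are no loops and no
  arcs between \<open>s\<close> and \<open>t\<close>.\<close>

lemma inj_on_tau_arc: "inj_on (tau_arc s t x0) (parcs G)"
proof (rule inj_onI, clarify)
  fix a b c d
  assume *: "(a, b) \<in> parcs G" "(c, d) \<in> parcs G" "tau_arc s t x0 (a, b) = tau_arc s t x0 (c, d)"
  then have "a \<noteq> b" "c \<noteq> d" "(a, b) \<noteq> (s, t)" "(a, b) \<noteq> (t, s)" "(c, d) \<noteq> (s, t)" "(c, d) \<noteq> (t, s)"
    using no_loops no_arc_st no_arc_ts by fastforce+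
  with * arc_neq_x0 show "a = c \<and> b = d"
    by (auto simp: tau_arc_def tau_def doubleton_eq_iff split: if_splits)
qed

lemma literal_in_tau_arc:
  assumes "e \<in> parcs G" "v \<notin> {s, t, x0}"
  shows "Pos v \<in> tau_arc s t x0 e \<longleftrightarrow> snd e = v" "Neg v \<in> tau_arc s t x0 e \<longleftrightarrow> fst e = v"
  using assms by (auto simp: tau_arc_def tau_def)

lemma x0_literal_in_tau_arc:
  assumes "e \<in> parcs G"
  shows "Pos x0 \<in> tau_arc s t x0 e \<longleftrightarrow> snd e = s \<or> fst e = t"
    "Neg x0 \<in> tau_arc s t x0 e \<longleftrightarrow> fst e = s \<or> snd e = t"
  using assms arc_neq_x0[of "fst e" "snd e"] distinct_st_x0 by (auto simp: tau_arc_def tau_def)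

lemma ldeg_tFC: "ldeg (tFC G s t x0) x = card {e \<in> parcs G. x \<in> tau_arc s t x0 e}"
proof -
  have "{C \<in> tFC G s t x0. x \<in> C} = tau_arc s t x0 ` {e \<in> parcs G. x \<in> tau_arc s t x0 e}"
    by (auto simp: tFC_def)
  then show ?thesis
    using inj_on_subset[OF inj_on_tau_arc] by (simp add: ldeg_def card_image)
qed

lemma vdeg_tFC:
  assumes "v \<notin> {s, t, x0}"
  shows "vdeg (tFC G s t x0) v = in_degree (with_proj G) v + out_degree (with_proj G) v"
proof -
  have "{e \<in> parcs G. Pos v \<in> tau_arc s t x0 e} = in_arcs (with_proj G) v"
    "{e \<in> parcs G. Neg v \<in> tau_arc s t x0 e} = out_arcs (with_proj G) v"
    using literal_in_tau_arc assms by auto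
  then show ?thesis
    by (simp add: vdeg_def ldeg_tFC in_degree_def out_degree_def)
qed

lemma vdeg_tFC_x0:
  "vdeg (tFC G s t x0) x0 =
     in_degree (with_proj G) s + out_degree (with_proj G) s +
     in_degree (with_proj G) t + out_degree (with_proj G) t"
proof -
  have "{e \<in> parcs G. Pos x0 \<in> tau_arc s t x0 e} = in_arcs (with_proj G) s \<union> out_arcs (with_proj G) t"
    "{e \<in> parcs G. Neg x0 \<in> tau_arc s t x0 e} = out_arcs (with_proj G) s \<union> in_arcs (with_proj G) t"
    using x0_literal_in_tau_arc by auto
  \<comment> \<open>A common element would be the arc \<open>(t, s)\<close> or
    \<open>(s, t)\<close>; the absence of both lets the four degrees simply add up.\<close>
  moreover have "in_arcs (with_proj G) s \<inter> out_arcs (with_proj G) t = {}"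
    "out_arcs (with_proj G) s \<inter> in_arcs (with_proj G) t = {}"
    using no_arc_st no_arc_ts by auto
  ultimately show ?thesis
    by (simp add: vdeg_def ldeg_tFC in_degree_def out_degree_def card_Un_disjoint
        finite_in_arcs finite_out_arcs)
qed

lemma card_clause_le_2: "C \<in> tFC G s t x0 \<Longrightarrow> card C \<le> 2"
  by (auto simp: tFC_def tau_arc_def card_insert_if)

lemma vars_tFC: "vars (tFC G s t x0) = (\<lambda>v. if v = s \<or> v = t then x0 else v) ` Field (parcs G)"
proof -
  have "var_lit (tau s t x0 v) = (if v = s \<or> v = t then x0 else v)" for v
    by (simp add: tau_def)
  then have "var_lit ` tau_arc s t x0 e = (\<lambda>v. if v = s \<or> v = t then x0 else v) ` {fst e, snd e}" for e
    by (simp only: tau_arc_def image_insert image_empty var_lit_compl_lit)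
  then have "vars (tFC G s t x0) =
      (\<Union>e\<in>parcs G. (\<lambda>v. if v = s \<or> v = t then x0 else v) ` {fst e, snd e})"
    unfolding vars_def tFC_def by (simp only: image_Union image_image)
  also have "\<dots> = (\<lambda>v. if v = s \<or> v = t then x0 else v) ` (\<Union>e\<in>parcs G. {fst e, snd e})"
    by blast
  also have "(\<Union>e\<in>parcs G. {fst e, snd e}) = Field (parcs G)"
    by (force simp: Field_def)
  finally show ?thesis .
qed

section \<open>Satisfiability, separation and reachability\<close>

text \<open>The clause of an arc \<open>(a, b)\<close> is the implication from the literal of \<open>a\<close> to that of \<open>b\<close>,
  and the literals of \<open>s\<close> and \<open>t\<close> are complementary.\<close>

lemma satisfiable_tFC_iff_separating:
  "satisfiable (tFC G s t x0) \<longleftrightarrow> (\<exists>S. parcs G `` S \<subseteq> S \<and> (s \<in> S \<longleftrightarrow> t \<notin> S))"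
proof
  assume "satisfiable (tFC G s t x0)"
  then obtain \<phi> where \<phi>: "\<exists>x\<in>tau_arc s t x0 e. lit_true \<phi> x" if "e \<in> parcs G" for e
    unfolding satisfiable_def tFC_def by auto
  define S where "S = {v. lit_true \<phi> (tau s t x0 v)}"
  have "parcs G `` S \<subseteq> S"
    using \<phi> unfolding S_def by (fastforce simp: tau_arc_def lit_true_compl_lit)
  moreover have "s \<in> S \<longleftrightarrow> t \<notin> S"
    using distinct_st_x0 by (simp add: S_def tau_def)
  ultimately show "\<exists>S. parcs G `` S \<subseteq> S \<and> (s \<in> S \<longleftrightarrow> t \<notin> S)"
    by blast
next
  assume "\<exists>S. parcs G `` S \<subseteq> S \<and> (s \<in> S \<longleftrightarrow> t \<notin> S)"
  then obtain S where S: "parcs G `` S \<subseteq> S" "s \<in> S \<longleftrightarrow> t \<notin> S"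
    by blast
  \<comment> \<open>The variable \<open>x0\<close> stands for \<open>s\<close>; its complement then
    matches \<open>t\<close>, because exactly one of \<open>s\<close> and \<open>t\<close> lies in
    \<open>S\<close>.\<close>
  define \<phi> where "\<phi> v = (if v = x0 then s \<in> S else v \<in> S)" for v
  have true: "lit_true \<phi> (tau s t x0 v) \<longleftrightarrow> v \<in> S" if "v \<noteq> x0" for v
    using S(2) that by (auto simp: tau_def \<phi>_def)
  have "\<exists>x\<in>tau_arc s t x0 (a, b). lit_true \<phi> x" if "(a, b) \<in> parcs G" for a b
    using true[of a] true[of b] arc_neq_x0[OF that] S(1) that
    by (auto simp: tau_arc_def lit_true_compl_lit)
  then show "satisfiable (tFC G s t x0)"
    unfolding satisfiable_def tFC_def by (intro exI[of _ \<phi>]) auto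
qed

text \<open>A closed set containing exactly one of \<open>s\<close> and \<open>t\<close> blocks one
  direction. Conversely, if one of them does not reach the other, the set of vertices reachable from
  it is closed and separates them.\<close>

lemma satisfiable_tFC_iff_rtrancl:
  "satisfiable (tFC G s t x0) \<longleftrightarrow> \<not> ((s, t) \<in> (parcs G)\<^sup>* \<and> (t, s) \<in> (parcs G)\<^sup>*)"
proof -
  have closed: "y \<in> S" if "(x, y) \<in> (parcs G)\<^sup>*" "x \<in> S" "parcs G `` S \<subseteq> S" for x y S
    using that by (induction rule: rtrancl_induct) auto
  show ?thesis
    unfolding satisfiable_tFC_iff_separating
  proof
    assume "\<exists>S. parcs G `` S \<subseteq> S \<and> (s \<in> S \<longleftrightarrow> t \<notin> S)"
    then show "\<not> ((s, t) \<in> (parcs G)\<^sup>* \<and> (t, s) \<in> (parcs G)\<^sup>*)"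
      using closed by blast
  next
    have "parcs G `` ((parcs G)\<^sup>* `` {x}) \<subseteq> (parcs G)\<^sup>* `` {x}" for x
      by (auto intro: rtrancl_into_rtrancl)
    moreover assume "\<not> ((s, t) \<in> (parcs G)\<^sup>* \<and> (t, s) \<in> (parcs G)\<^sup>*)"
    ultimately show "\<exists>S. parcs G `` S \<subseteq> S \<and> (s \<in> S \<longleftrightarrow> t \<notin> S)"
      by (metis Image_singleton_iff rtrancl.rtrancl_refl)
  qed
qed

text \<open>A walk is shortened to a path by cutting out its cycles. The hypothesis on
  \<open>u\<close> concerns the trivial path, since \<open>rtrancl\<close> is reflexive outside
  \<open>pverts G\<close> as well.\<close>

lemma ex_dipath_iff_rtrancl:
  assumes "u \<in> pverts G"
  shows "(\<exists>p. dipath G u p v) \<longleftrightarrow> (u, v) \<in> (parcs G)\<^sup>*"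
proof
  assume "\<exists>p. dipath G u p v"
  then show "(u, v) \<in> (parcs G)\<^sup>*"
    using rtrancl_vwalk_arcs by (auto simp: dipath_conv)
next
  assume "(u, v) \<in> (parcs G)\<^sup>*"
  then have "\<exists>p. vwalk p (with_proj G) \<and> hd p = u \<and> last p = v"
  proof (induction rule: converse_rtrancl_induct)
    case base
    have "v \<in> pverts G"
      using \<open>(u, v) \<in> (parcs G)\<^sup>*\<close> assms by (induction rule: rtrancl_induct) (auto dest: in_arcsD2)
    then show ?case
      by (intro exI[of _ "[v]"]) (auto simp: vwalk_def)
  next
    case (step a b)
    then obtain p where "vwalk p (with_proj G)" "hd p = b" "last p = v"
      by blast
    then show ?case
      using step(1) vwalk_wf_digraph_consI[of p a]
      by (intro exI[of _ "a # p"]) (auto simp: vwalk_def)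
  qed
  then obtain p where "vwalk p (with_proj G)" "hd p = u" "last p = v"
    by blast
  from vwalk_imp_ex_vpath[OF this] show "\<exists>p. dipath G u p v"
    unfolding dipath_def .
qed

lemma special_closed_walk_iff_unsatisfiable:
  "special_closed_walk G s t \<longleftrightarrow> \<not> satisfiable (tFC G s t x0)"
  using ex_dipath_iff_rtrancl[OF s_in_verts] ex_dipath_iff_rtrancl[OF t_in_verts]
  unfolding special_closed_walk_def satisfiable_tFC_iff_rtrancl by blast

lemma satisfiable_tFC_if_degree_0:
  assumes "\<not> (in_arcs (with_proj G) s \<noteq> {} \<and> out_arcs (with_proj G) s \<noteq> {} \<and>
         in_arcs (with_proj G) t \<noteq> {} \<and> out_arcs (with_proj G) t \<noteq> {})"
  shows "satisfiable (tFC G s t x0)"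
proof (rule ccontr)
  assume "\<not> satisfiable (tFC G s t x0)"
  \<comment> \<open>As \<open>s\<close> and \<open>t\<close> differ, neither connection is trivial;
    the first and last arcs of both supply the four required arcs.\<close>
  then have "(s, t) \<in> (parcs G)\<^sup>+" "(t, s) \<in> (parcs G)\<^sup>+"
    using distinct_st_x0 unfolding satisfiable_tFC_iff_rtrancl by (auto dest: rtranclD)
  then obtain a b c d where "(s, a) \<in> parcs G" "(b, t) \<in> parcs G" "(t, c) \<in> parcs G" "(d, s) \<in> parcs G"
    by (meson tranclD tranclD2)
  then have "(d, s) \<in> in_arcs (with_proj G) s" "(s, a) \<in> out_arcs (with_proj G) s"
    "(b, t) \<in> in_arcs (with_proj G) t" "(t, c) \<in> out_arcs (with_proj G) t"
    by auto
  with assms show False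
    by blast
qed

end

section \<open>Digraphs whose arcs are those of two opposite paths\<close>

text \<open>This is the shape of a special closed walk. The paths may share inner vertices and even
  arcs; vertices of \<open>G\<close> on neither path are isolated.\<close>

locale st_walk = st_digraph +
  fixes P Q :: "'a list"
  assumes P: "dipath G s P t" and Q: "dipath G t Q s"
    and parcs_eq: "parcs G = set (vwalk_arcs P) \<union> set (vwalk_arcs Q)"
begin

lemma P': "P \<noteq> []" "distinct P" "hd P = s" "last P = t"
  and Q': "Q \<noteq> []" "distinct Q" "hd Q = t" "last Q = s"
  using P Q by (auto simp: dipath_conv)

lemma st_in_walks: "s \<in> set (butlast P)" "t \<in> set (tl P)" "t \<in> set (butlast Q)" "s \<in> set (tl Q)"
proof -
  have "set P = insert t (set (butlast P))" "set P = insert s (set (tl P))"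
    "set Q = insert s (set (butlast Q))" "set Q = insert t (set (tl Q))"
    using P' Q' set_butlast_last set_hd_tl by metis+
  then show "s \<in> set (butlast P)" "t \<in> set (tl P)" "t \<in> set (butlast Q)" "s \<in> set (tl Q)"
    using distinct_st_x0 by (metis insertE insertI1)+
qed

lemma st_notin_walks: "t \<notin> set (butlast P)" "s \<notin> set (tl P)" "s \<notin> set (butlast Q)" "t \<notin> set (tl Q)"
  using P' Q' last_notin_butlast hd_notin_tl by metis+

text \<open>Each path ends where the other one starts, so every vertex on the paths has an outgoing
  arc.\<close>

lemma Domain_parcs: "Domain (parcs G) = set P \<union> set Q"
  using st_in_walks set_butlast_last[OF P'(1)] set_butlast_last[OF Q'(1)]
  unfolding parcs_eq Domain_Un_eq Domain_vwalk_arcs P' Q' by (simp add: insert_absorb)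

lemma Range_parcs: "Range (parcs G) = set P \<union> set Q"
  using st_in_walks set_hd_tl[OF P'(1)] set_hd_tl[OF Q'(1)]
  unfolding parcs_eq Range_Un_eq Range_vwalk_arcs P' Q' by (simp add: insert_absorb)

text \<open>The hypothesis says that exactly one of the two paths leaves \<open>v\<close>. This
  always holds for \<open>s\<close> and \<open>t\<close>, and for the inner vertices if the paths
  are internally disjoint.\<close>

lemma out_degree_eq_1:
  assumes "v \<in> set (butlast P) \<longleftrightarrow> v \<notin> set (butlast Q)"
  shows "out_degree (with_proj G) v = 1"
proof (cases "v \<in> set (butlast P)")
  case True
  then show ?thesis
    using assms ex1_vwalk_arcs_out[OF P'(2) True] vwalk_arcs_out[of v _ Q]
    unfolding out_degree_eq_1_iff parcs_eq Un_iff by metis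
next
  case False
  then show ?thesis
    using assms ex1_vwalk_arcs_out[OF Q'(2), of v] vwalk_arcs_out[of v _ P]
    unfolding out_degree_eq_1_iff parcs_eq Un_iff by metis
qed

lemma in_degree_eq_1:
  assumes "v \<in> set (tl P) \<longleftrightarrow> v \<notin> set (tl Q)"
  shows "in_degree (with_proj G) v = 1"
proof (cases "v \<in> set (tl P)")
  case True
  then show ?thesis
    using assms ex1_vwalk_arcs_in[OF P'(2) True] vwalk_arcs_in[of _ v Q]
    unfolding in_degree_eq_1_iff parcs_eq Un_iff by metis
next
  case False
  then show ?thesis
    using assms ex1_vwalk_arcs_in[OF Q'(2), of v] vwalk_arcs_in[of _ v P]
    unfolding in_degree_eq_1_iff parcs_eq Un_iff by metis
qed

lemma degree_st:
  "out_degree (with_proj G) s = 1" "in_degree (with_proj G) s = 1"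
  "out_degree (with_proj G) t = 1" "in_degree (with_proj G) t = 1"
  using out_degree_eq_1[of s] in_degree_eq_1[of s] out_degree_eq_1[of t] in_degree_eq_1[of t]
    st_in_walks st_notin_walks by simp_all

lemma vdeg_x0: "vdeg (tFC G s t x0) x0 = 4"
  by (simp add: vdeg_tFC_x0 degree_st[unfolded One_nat_def])

lemma vars_walk: "vars (tFC G s t x0) = insert x0 (set P \<union> set Q - {s, t})"
proof -
  have "Field (parcs G) = set P \<union> set Q" "s \<in> set P"
    using Domain_parcs Range_parcs st_in_walks(1) by (auto simp: Field_def dest: in_set_butlastD)
  then show ?thesis
    unfolding vars_tFC by auto
qed

text \<open>The vertices \<open>s\<close> and \<open>t\<close> merge into the one variable
  \<open>x0\<close>, which is not itself a vertex, so exactly one is lost.\<close>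

lemma card_vars_walk: "card (vars (tFC G s t x0)) + 1 = card (set P \<union> set Q)"
proof -
  have "s \<in> set P" "t \<in> set Q"
    using st_in_walks by (auto dest: in_set_butlastD)
  then have "card (set P \<union> set Q) = card (set P \<union> set Q - {s, t}) + 2"
    using card_Diff_subset[of "{s, t}" "set P \<union> set Q"] card_mono[of "set P \<union> set Q" "{s, t}"]
      distinct_st_x0 by simp
  moreover have "x0 \<notin> set P \<union> set Q"
    using P Q x0_notin_verts by (auto simp: dipath_conv)
  ultimately show ?thesis
    by (simp add: vars_walk)
qed

section \<open>Internal disjointness, minimal unsatisfiability, Family III and deficiency\<close>

lemma disjoint_if_single_valued:
  assumes sv: "single_valued (parcs G)"
  shows "set P \<inter> set Q = {s, t}"
proof -
  have "v \<in> {s, t}" if v: "v \<in> set P" "v \<in> set Q" for v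
  proof (rule ccontr)
    assume v': "v \<notin> {s, t}"
    obtain xs ys where p: "P = xs @ v # ys"
      using v(1) by (metis split_list)
    obtain xs' ys' where q: "Q = xs' @ v # ys'"
      using v(2) by (metis split_list)
    have "xs \<noteq> []" "xs' \<noteq> []"
      using v' P' Q' p q by auto
    then have "s \<in> set xs" "t \<in> set xs'"
      using P'(3) Q'(3) p q by (metis hd_append2 hd_in_set)+
    then have "s \<notin> set (v # ys)" "t \<notin> set (v # ys')"
      using P' Q' p q by auto
    moreover have "t \<in> set (v # ys)" "s \<in> set (v # ys')"
      using P' Q' p q last_in_set[of "v # ys"] last_in_set[of "v # ys'"] by auto
    moreover have "set (vwalk_arcs (v # ys)) \<subseteq> parcs G" "set (vwalk_arcs (v # ys')) \<subseteq> parcs G"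
      using set_vwalk_arcs_append2[of "v # ys" xs] set_vwalk_arcs_append2[of "v # ys'" xs']
      unfolding parcs_eq p q by auto
    \<comment> \<open>Each of the two tails has a vertex that the other lacks: \<open>t\<close> is
      only in \<open>v # ys\<close>, and \<open>s\<close> only in \<open>v # ys'\<close>.\<close>
    ultimately show False
      using single_valued_walks_comparable[OF sv] by blast
  qed
  moreover have "{s, t} \<subseteq> set P \<inter> set Q"
    using P' Q' by (metis Int_subset_iff empty_subsetI hd_in_set insert_subset last_in_set)
  ultimately show "set P \<inter> set Q = {s, t}"
    by blast
qed

text \<open>Dropping a clause drops one arc. This breaks one path, and the other path offers no
  detour around the gap because it shares only \<open>s\<close> and \<open>t\<close> with
  it.\<close>

lemma minimally_unsat_if_disjoint:
  assumes disj: "set P \<inter> set Q = {s, t}"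
  shows "minimally_unsat (tFC G s t x0)"
  unfolding minimally_unsat_def
proof (intro conjI ballI)
  show "clause_set (tFC G s t x0)"
    by (rule clause_set_tFC)
  show "\<not> satisfiable (tFC G s t x0)"
    using P Q special_closed_walk_iff_unsatisfiable unfolding special_closed_walk_def by blast
  fix C
  assume "C \<in> tFC G s t x0"
  then obtain e where e: "e \<in> parcs G" "C = tau_arc s t x0 e"
    by (auto simp: tFC_def)
  interpret H: st_digraph "G\<lparr>parcs := parcs G - {e}\<rparr>" s t x0
    by (rule st_digraph_restrict) blast
  have "\<exists>S. (parcs G - {e}) `` S \<subseteq> S \<and> (s \<in> S \<longleftrightarrow> t \<notin> S)"
  proof (cases "e \<in> set (vwalk_arcs P)")
    case True
    then show ?thesis
      using separating_set_disjoint_paths[of P Q e] P' Q' disj unfolding parcs_eq by auto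
  next
    case False
    then have "e \<in> set (vwalk_arcs Q)"
      using e unfolding parcs_eq by blast
    \<comment> \<open>The roles of \<open>P\<close> and \<open>Q\<close> are exchanged, so this set
      contains \<open>t\<close> instead of \<open>s\<close>.\<close>
    then obtain S where "(set (vwalk_arcs Q) \<union> set (vwalk_arcs P) - {e}) `` S \<subseteq> S \<and> t \<in> S \<and> s \<notin> S"
      using separating_set_disjoint_paths[of Q P e] P' Q' disj by auto
    then show ?thesis
      unfolding parcs_eq by (metis Un_commute)
  qed
  then have "satisfiable (tFC (G\<lparr>parcs := parcs G - {e}\<rparr>) s t x0)"
    unfolding H.satisfiable_tFC_iff_separating by simp
  moreover have "tFC G s t x0 - {C} \<subseteq> tFC (G\<lparr>parcs := parcs G - {e}\<rparr>) s t x0"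
    using e by (auto simp: tFC_def)
  ultimately show "satisfiable (tFC G s t x0 - {C})"
    by (rule satisfiable_mono)
qed

text \<open>Each of the two paths leaves \<open>v\<close> at most once.\<close>

lemma out_degree_le_2: "out_degree (with_proj G) v \<le> 2"
proof -
  have le_1: "card {e \<in> set (vwalk_arcs p). fst e = v} \<le> 1" if "distinct p" for p
    using single_valued_vwalk_arcs[OF that] by (auto simp: card_le_Suc0_iff_eq single_valued_def)
  then have "card {e \<in> set (vwalk_arcs P). fst e = v} + card {e \<in> set (vwalk_arcs Q). fst e = v} \<le> 2"
    using add_mono[OF le_1[OF P'(2)] le_1[OF Q'(2)]] by simp
  moreover have "out_arcs (with_proj G) v =
      {e \<in> set (vwalk_arcs P). fst e = v} \<union> {e \<in> set (vwalk_arcs Q). fst e = v}"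
    by (auto simp: parcs_eq)
  ultimately show ?thesis
    using card_Un_le[of "{e \<in> set (vwalk_arcs P). fst e = v}" "{e \<in> set (vwalk_arcs Q). fst e = v}"]
    by (simp add: out_degree_def)
qed

lemma in_degree_le_2: "in_degree (with_proj G) v \<le> 2"
proof -
  have le_1: "card {e \<in> set (vwalk_arcs p). snd e = v} \<le> 1" if "distinct p" for p
    using single_valued_converse_vwalk_arcs[OF that]
    by (auto simp: card_le_Suc0_iff_eq single_valued_def)
  then have "card {e \<in> set (vwalk_arcs P). snd e = v} + card {e \<in> set (vwalk_arcs Q). snd e = v} \<le> 2"
    using add_mono[OF le_1[OF P'(2)] le_1[OF Q'(2)]] by simp
  moreover have "in_arcs (with_proj G) v =
      {e \<in> set (vwalk_arcs P). snd e = v} \<union> {e \<in> set (vwalk_arcs Q). snd e = v}"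
    by (auto simp: parcs_eq)
  ultimately show ?thesis
    using card_Un_le[of "{e \<in> set (vwalk_arcs P). snd e = v}" "{e \<in> set (vwalk_arcs Q). snd e = v}"]
    by (simp add: in_degree_def)
qed

text \<open>Since \<open>x0\<close> has degree 4, Family III forbids degrees 3 and 4 elsewhere. In-
  and out-degrees of inner vertices are 1 or 2, so all of them become 1 and
  \<open>disjoint_if_single_valued\<close> applies. Conversely, disjoint paths give every inner
  vertex degree 2.\<close>

lemma family_III_iff_disjoint: "family_III (tFC G s t x0) \<longleftrightarrow>
    minimally_unsat (tFC G s t x0) \<and> set P \<inter> set Q = {s, t}"
proof (rule iffI; (elim conjE)?)
  assume "family_III (tFC G s t x0)"
  then have MU: "minimally_unsat (tFC G s t x0)" and n3: "num_vars_deg 3 (tFC G s t x0) = 0"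
    and n4: "num_vars_deg 4 (tFC G s t x0) = 1"
    by (auto simp: family_III_def)
  have no34: "vdeg (tFC G s t x0) v \<noteq> 3 \<and> vdeg (tFC G s t x0) v \<noteq> 4"
    if "v \<in> vars (tFC G s t x0)" "v \<noteq> x0" for v
  proof -
    have "finite (vars (tFC G s t x0))"
      unfolding vars_walk by simp
    then have "{v \<in> vars (tFC G s t x0). vdeg (tFC G s t x0) v = 3} = {}"
      using n3 by (simp add: num_vars_deg_def)
    moreover obtain u where u: "{v \<in> vars (tFC G s t x0). vdeg (tFC G s t x0) v = 4} = {u}"
      using n4 unfolding num_vars_deg_def by (rule card_1_singletonE)
    have "x0 \<in> {v \<in> vars (tFC G s t x0). vdeg (tFC G s t x0) v = 4}"
      using vdeg_x0 vars_walk by simp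
    \<comment> \<open>The only variable of degree 4 must be \<open>x0\<close>, so no other variable
      has this degree.\<close>
    then have "u = x0"
      unfolding u by simp
    then have "v \<notin> {v \<in> vars (tFC G s t x0). vdeg (tFC G s t x0) v = 4}"
      using that unfolding u by simp
    ultimately show ?thesis
      using that by simp
  qed
  have "\<exists>!w. (v, w) \<in> parcs G" if v: "v \<in> set P \<union> set Q" for v
  proof (cases "v = s \<or> v = t")
    case True
    then show ?thesis
      using degree_st out_degree_eq_1_iff by metis
  next
    case False
    moreover have "v \<noteq> x0"
      using v P Q x0_notin_verts by (auto simp: dipath_conv)
    ultimately have "in_degree (with_proj G) v + out_degree (with_proj G) v \<notin> {3, 4}"
      using no34[of v] v vdeg_tFC[of v] by (simp add: vars_walk)
    moreover have "in_degree (with_proj G) v \<noteq> 0" "out_degree (with_proj G) v \<noteq> 0"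
    proof -
      obtain u w where "(u, v) \<in> parcs G" "(v, w) \<in> parcs G"
        using v Domain_parcs Range_parcs by blast
      then have "(u, v) \<in> in_arcs (with_proj G) v" "(v, w) \<in> out_arcs (with_proj G) v"
        by simp_all
      then show "in_degree (with_proj G) v \<noteq> 0" "out_degree (with_proj G) v \<noteq> 0"
        unfolding in_degree_def out_degree_def card_eq_0_iff
        using finite_in_arcs[of v] finite_out_arcs[of v] by blast+
    qed
    moreover have "in_degree (with_proj G) v \<le> 2" "out_degree (with_proj G) v \<le> 2"
      by (rule in_degree_le_2 out_degree_le_2)+
    ultimately have "out_degree (with_proj G) v = 1"
      by auto
    then show ?thesis
      by (simp only: out_degree_eq_1_iff)
  qed
  then have "single_valued (parcs G)"
    using Domain_parcs unfolding single_valued_def by blast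
  then show "minimally_unsat (tFC G s t x0) \<and> set P \<inter> set Q = {s, t}"
    using MU disjoint_if_single_valued by blast
next
  assume disj: "set P \<inter> set Q = {s, t}"
  have deg2: "vdeg (tFC G s t x0) v = 2" if "v \<in> set P \<union> set Q - {s, t}" for v
  proof -
    \<comment> \<open>An inner vertex is neither first nor last on a path, so cutting off an end
      does not affect its membership.\<close>
    have "v \<in> set (butlast P) \<longleftrightarrow> v \<in> set P" "v \<in> set (butlast Q) \<longleftrightarrow> v \<in> set Q"
      "v \<in> set (tl P) \<longleftrightarrow> v \<in> set P" "v \<in> set (tl Q) \<longleftrightarrow> v \<in> set Q"
      using that set_butlast_last[OF P'(1)] set_butlast_last[OF Q'(1)]
        set_hd_tl[OF P'(1)] set_hd_tl[OF Q'(1)] unfolding P' Q'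
      by (metis Diff_iff insert_iff)+
    moreover have "v \<in> set P \<longleftrightarrow> v \<notin> set Q"
      using that disj by blast
    ultimately have "v \<in> set (butlast P) \<longleftrightarrow> v \<notin> set (butlast Q)" "v \<in> set (tl P) \<longleftrightarrow> v \<notin> set (tl Q)"
      by simp_all
    then have "out_degree (with_proj G) v = 1" "in_degree (with_proj G) v = 1"
      using out_degree_eq_1 in_degree_eq_1 by simp_all
    moreover have "v \<noteq> x0"
      using that P Q x0_notin_verts by (auto simp: dipath_conv)
    ultimately show ?thesis
      using that vdeg_tFC by auto
  qed
  then have deg_eqs: "{v \<in> vars (tFC G s t x0). vdeg (tFC G s t x0) v = 3} = {}"
    "{v \<in> vars (tFC G s t x0). vdeg (tFC G s t x0) v = 4} = {x0}"
    using vdeg_x0 unfolding vars_walk by auto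
  then show "family_III (tFC G s t x0)"
    unfolding family_III_def num_vars_deg_def deg_eqs
    using minimally_unsat_if_disjoint[OF disj] card_clause_le_2 by simp
qed

text \<open>\<open>\<delta> = |E| - |V| + 1\<close>, and \<open>|E| \<ge> |V|\<close> with equality only if all out-degrees are 1.\<close>

lemma deficiency_ge_2_if_not_disjoint:
  assumes "set P \<inter> set Q \<noteq> {s, t}"
  shows "deficiency (tFC G s t x0) \<ge> 2"
proof -
  have img: "fst ` parcs G = set P \<union> set Q"
    using Domain_parcs by (simp add: Domain_fst)
  \<comment> \<open>Some vertex has two outgoing arcs, so there are strictly more arcs than tails of
    arcs.\<close>
  have "\<not> inj_on fst (parcs G)"
    using assms disjoint_if_single_valued
    by (fastforce simp: single_valued_def inj_on_def)
  then have "card (fst ` parcs G) < card (parcs G)"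
    using pair_finite_arcs by (meson card_image_le eq_card_imp_inj_on le_neq_implies_less)
  \<comment> \<open>One unit comes from merging \<open>s\<close> and \<open>t\<close>, the other
    from the strict inequality.\<close>
  then have "card (vars (tFC G s t x0)) + 2 \<le> card (parcs G)"
    using card_vars_walk img by simp
  moreover have "card (tFC G s t x0) = card (parcs G)"
    unfolding tFC_def by (rule card_image[OF inj_on_tau_arc])
  ultimately show ?thesis
    by (simp add: deficiency_def)
qed

end

section \<open>Transfer to minimally unsatisfiable subsets in an arbitrary st-digraph\<close>

context st_digraph
begin

lemma st_walk_restrict:
  assumes "dipath G s P t" "dipath G t Q s"
  shows "st_walk (G\<lparr>parcs := set (vwalk_arcs P) \<union> set (vwalk_arcs Q)\<rparr>) s t x0 P Q"
proof -
  interpret H: st_digraph "G\<lparr>parcs := set (vwalk_arcs P) \<union> set (vwalk_arcs Q)\<rparr>" s t x0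
    using assms by (intro st_digraph_restrict) (auto simp: dipath_conv)
  show ?thesis
    using assms by unfold_locales (auto simp: dipath_conv)
qed

text \<open>A minimally unsatisfiable subset has no clauses beyond those of the two paths
  witnessing its unsatisfiability.\<close>

lemma is_MUS_tFC_E:
  assumes "is_MUS F (tFC G s t x0)"
  obtains P Q where "dipath G s P t" "dipath G t Q s"
    "F = tFC (G\<lparr>parcs := set (vwalk_arcs P) \<union> set (vwalk_arcs Q)\<rparr>) s t x0"
proof -
  have F: "F \<subseteq> tFC G s t x0" "\<not> satisfiable F" "\<And>C. C \<in> F \<Longrightarrow> satisfiable (F - {C})"
    using assms by (auto simp: is_MUS_def minimally_unsat_def)
  obtain E where E: "E \<subseteq> parcs G" "F = tau_arc s t x0 ` E"
    using F(1) unfolding tFC_def by (metis subset_image_iff)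
  interpret H: st_digraph "G\<lparr>parcs := E\<rparr>" s t x0
    using E(1) by (rule st_digraph_restrict)
  have "special_closed_walk (G\<lparr>parcs := E\<rparr>) s t"
    using F(2) E(2) H.special_closed_walk_iff_unsatisfiable by (simp add: tFC_def)
  then obtain P Q where PQ: "dipath (G\<lparr>parcs := E\<rparr>) s P t" "dipath (G\<lparr>parcs := E\<rparr>) t Q s"
    unfolding special_closed_walk_def by blast
  let ?H = "G\<lparr>parcs := set (vwalk_arcs P) \<union> set (vwalk_arcs Q)\<rparr>"
  have G: "dipath G s P t" "dipath G t Q s"
    using PQ dipath_restrict[OF E(1)] by blast+
  interpret W: st_walk ?H s t x0 P Q
    using G by (rule st_walk_restrict)
  have sub: "tFC ?H s t x0 \<subseteq> F"
    using PQ unfolding E(2) tFC_def by (auto simp: dipath_conv)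
  have "\<not> satisfiable (tFC ?H s t x0)"
    using W.P W.Q W.special_closed_walk_iff_unsatisfiable unfolding special_closed_walk_def by blast
  \<comment> \<open>Removing a clause of \<open>F\<close> outside \<open>tFC ?H s t x0\<close> would
    leave an unsatisfiable subset in place, against minimality.\<close>
  then have "F = tFC ?H s t x0"
    using F(3) sub satisfiable_mono by (metis Diff_empty subsetI subset_Diff_insert subset_antisym)
  then show thesis
    using that G by blast
qed

text \<open>The two paths of a special cycle translate into the desired subset. Conversely, a
  minimally unsatisfiable subset is the translation of two paths by \<open>is_MUS_tFC_E\<close>, and
  Family III makes these internally disjoint.\<close>

lemma special_cycle_iff_family_III:
  "special_cycle G s t \<longleftrightarrow> (\<exists>F. is_MUS F (tFC G s t x0) \<and> family_III F)"
proof
  assume "special_cycle G s t"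
  then obtain P Q where PQ: "dipath G s P t" "dipath G t Q s" "set P \<inter> set Q = {s, t}"
    unfolding special_cycle_def by blast
  let ?H = "G\<lparr>parcs := set (vwalk_arcs P) \<union> set (vwalk_arcs Q)\<rparr>"
  interpret W: st_walk ?H s t x0 P Q
    using PQ(1,2) by (rule st_walk_restrict)
  have "minimally_unsat (tFC ?H s t x0)" "family_III (tFC ?H s t x0)"
    using W.family_III_iff_disjoint W.minimally_unsat_if_disjoint PQ(3) by blast+
  moreover have "tFC ?H s t x0 \<subseteq> tFC G s t x0"
    using PQ unfolding tFC_def by (auto simp: dipath_conv)
  ultimately show "\<exists>F. is_MUS F (tFC G s t x0) \<and> family_III F"
    unfolding is_MUS_def by blast
next
  assume "\<exists>F. is_MUS F (tFC G s t x0) \<and> family_III F"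
  then obtain F where F: "is_MUS F (tFC G s t x0)" "family_III F"
    by blast
  obtain P Q where PQ: "dipath G s P t" "dipath G t Q s"
    and F_eq: "F = tFC (G\<lparr>parcs := set (vwalk_arcs P) \<union> set (vwalk_arcs Q)\<rparr>) s t x0"
    using F(1) by (rule is_MUS_tFC_E)
  interpret W: st_walk "G\<lparr>parcs := set (vwalk_arcs P) \<union> set (vwalk_arcs Q)\<rparr>" s t x0 P Q
    using PQ by (rule st_walk_restrict)
  show "special_cycle G s t"
    using PQ F(2) W.family_III_iff_disjoint unfolding F_eq special_cycle_def by blast
qed

lemma vdeg_x0_MUS:
  assumes "is_MUS F (tFC G s t x0)"
  shows "vdeg F x0 = 4"
  using assms
proof (rule is_MUS_tFC_E)
  fix P Q
  assume PQ: "dipath G s P t" "dipath G t Q s"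
    and F_eq: "F = tFC (G\<lparr>parcs := set (vwalk_arcs P) \<union> set (vwalk_arcs Q)\<rparr>) s t x0"
  show ?thesis
    unfolding F_eq by (rule st_walk.vdeg_x0[OF st_walk_restrict[OF PQ]])
qed

lemma deficiency_MUS_ge_2:
  assumes "\<not> special_cycle G s t" and "is_MUS F (tFC G s t x0)"
  shows "deficiency F \<ge> 2"
  using assms(2)
proof (rule is_MUS_tFC_E)
  fix P Q
  assume PQ: "dipath G s P t" "dipath G t Q s"
    and F_eq: "F = tFC (G\<lparr>parcs := set (vwalk_arcs P) \<union> set (vwalk_arcs Q)\<rparr>) s t x0"
  have "set P \<inter> set Q \<noteq> {s, t}"
    using assms(1) PQ unfolding special_cycle_def by blast
  then show ?thesis
    unfolding F_eq by (rule st_walk.deficiency_ge_2_if_not_disjoint[OF st_walk_restrict[OF PQ]])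
qed

end

theorem theorem5p4:
  fixes G :: "'v pair_pre_digraph" and s t x0 :: 'v
  assumes "st_digraph G s t x0"
  shows
    "(\<not> (in_arcs (with_proj G) s \<noteq> {} \<and> out_arcs (with_proj G) s \<noteq> {} \<and>
         in_arcs (with_proj G) t \<noteq> {} \<and> out_arcs (with_proj G) t \<noteq> {}) \<longrightarrow>
       satisfiable (tFC G s t x0)) \<and>
     (\<forall>F'. is_MUS F' (tFC G s t x0) \<longrightarrow> vdeg F' x0 = 4) \<and>
     (special_closed_walk G s t \<longleftrightarrow> \<not> satisfiable (tFC G s t x0)) \<and>
     (special_cycle G s t \<longleftrightarrow> (\<exists>F'. is_MUS F' (tFC G s t x0) \<and> family_III F')) \<and>
     (\<not> special_cycle G s t \<longrightarrow>
       (\<forall>F'. is_MUS F' (tFC G s t x0) \<longrightarrow> deficiency F' \<ge> 2))"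
proof -
  interpret st_digraph G s t x0
    by (fact assms)
  show ?thesis
    using satisfiable_tFC_if_degree_0 vdeg_x0_MUS special_closed_walk_iff_unsatisfiable
      special_cycle_iff_family_III deficiency_MUS_ge_2 by blast
qed

end
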